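(* Let $\mathbb{F}_q$ be the finite field with $q$ elements. Each SQD class in $M_2(\mathbb{F}_q)$ (i.e. each set $\mathcal{C}((x-a)(x-b))$ of all matrices in $M_2(\mathbb{F}_q)$ with minimal polynomial $(x-a)(x-b)$, where $a,b\in\mathbb{F}_q$ and $a\neq b$) contains exactly $(q+1)(2^{q+1}-q-2)$ noncore subsets.
   Context: $M_2(\mathbb{F}_q)$ is the ring of $2\times 2$ matrices over $\mathbb{F}_q$. In the polynomial ring $M_2(\mathbb{F}_q)[x]$ the variable $x$ commutes with all coefficients, and polynomials are evaluated from the right: for $f=\sum_i \alpha_i x^i$ with $\alpha_i\in M_2(\mathbb{F}_q)$ and $A\in M_2(\mathbb{F}_q)$, $f(A)=\sum_i \alpha_i A^i$. For $S\subseteq M_2(\mathbb{F}_q)$, the null ideal of $S$ is $N(S)=\{f\in M_2(\mathbb{F}_q)[x] \mid f(A)=0 \text{ for all } A\in S\}$. The set $S$ is called core if $N(S)$ is a two-sided ideal of $M_2(\mathbb{F}_q)[x]$, and noncore otherwise. The empty set is core. *)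

theory Defs
  imports
    "HOL-Library.Cardinality"
    "HOL-Algebra.UnivPoly"
    "Jordan_Normal_Form.Matrix"
    "HOL-Computational_Algebra.Polynomial"
begin

abbreviation M2 :: "'a::field mat ring" where
  "M2 \<equiv> ring_mat TYPE('a) 2 ()"

text \<open>
  In \<open>UP R\<close> the indeterminate commutes with the coefficients, also when \<open>R\<close> is not commutative.
  The library's \<open>eval\<close> multiplies the powers of the argument by the coefficients from the left;
  for noncommutative \<open>R\<close> it is not a ring homomorphism.
\<close>

definition mpoly_eval :: "(nat \<Rightarrow> 'a::field mat) \<Rightarrow> 'a mat \<Rightarrow> 'a mat" where
  "mpoly_eval f A = UnivPoly.eval M2 M2 (\<lambda>\<alpha>. \<alpha>) A f"

definition null_ideal :: "'a::field mat set \<Rightarrow> (nat \<Rightarrow> 'a mat) set" where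
  "null_ideal S = {f \<in> carrier (UP M2). \<forall>A\<in>S. mpoly_eval f A = \<zero>\<^bsub>M2\<^esub>}"

text \<open>
  \<open>ideal\<close> means two-sided ideal. The next two notions are meant for sets \<open>S\<close> of
  two-by-two matrices, that is, \<open>S \<subseteq> carrier M2\<close>.
\<close>

definition core :: "'a::field mat set \<Rightarrow> bool" where
  "core S \<longleftrightarrow> ideal (null_ideal S) (UP M2)"

abbreviation noncore :: "'a::field mat set \<Rightarrow> bool" where
  "noncore S \<equiv> \<not> core S"

definition scalar_mpoly :: "'a::field poly \<Rightarrow> nat \<Rightarrow> 'a mat" where
  "scalar_mpoly p = (\<lambda>i. Polynomial.coeff p i \<cdot>\<^sub>m 1\<^sub>m 2)"

definition is_minimal_poly :: "'a::field mat \<Rightarrow> 'a poly \<Rightarrow> bool" where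
  "is_minimal_poly A m \<longleftrightarrow>
     lead_coeff m = 1 \<and> mpoly_eval (scalar_mpoly m) A = \<zero>\<^bsub>M2\<^esub> \<and>
     (\<forall>p. p \<noteq> 0 \<and> mpoly_eval (scalar_mpoly p) A = \<zero>\<^bsub>M2\<^esub> \<longrightarrow> degree m \<le> degree p)"

definition minpoly_class :: "'a::field poly \<Rightarrow> 'a mat set" where
  "minpoly_class m = {A \<in> carrier M2. is_minimal_poly A m}"

definition SQD_class :: "'a::field mat set \<Rightarrow> bool" where
  "SQD_class C \<longleftrightarrow> (\<exists>a b. a \<noteq> b \<and> C = minpoly_class ([:- a, 1:] * [:- b, 1:]))"

text \<open>
  Outside the carriers the library operations are unspecified; the following facts show that
  \<open>mpoly_eval\<close> is never applied there and computes the expected sums.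
\<close>

lemma ring_M2: "ring (M2 :: 'a::field mat ring)"
  by (rule ring_mat)

lemma scalar_mpoly_closed: "scalar_mpoly p \<in> carrier (UP M2)"
proof -
  have "bound (0\<^sub>m 2 2) (degree p) (scalar_mpoly p)"
    by (auto simp: scalar_mpoly_def coeff_eq_0 intro!: eq_matI)
  then show ?thesis
    by (auto simp: UP_def up_def ring_mat_simps scalar_mpoly_def)
qed

lemma mpoly_eval_eq:
  assumes f: "f \<in> carrier (UP M2)" and A: "A \<in> carrier M2" and n: "\<And>i. n < i \<Longrightarrow> f i = 0\<^sub>m 2 2"
  shows "mpoly_eval f A = (\<Oplus>\<^bsub>M2\<^esub>i\<in>{..n}. f i * A ^\<^sub>m i)"
proof -
  interpret UP_ring M2 "UP M2"
    by (simp add: UP_ring_def UP_def ring_M2)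
  have co: "UnivPoly.coeff (UP M2) f i = f i" for i
    using f by (simp add: UP_def)
  have fc: "f i \<in> carrier M2" for i
    using f by (auto simp: UP_def)
  have Ac: "A \<in> carrier_mat 2 2"
    using A by (simp add: ring_mat_simps)
  have pow: "A [^]\<^bsub>M2\<^esub> i = A ^\<^sub>m i" for i
    by (simp add: pow_mat_ring_pow[OF Ac, of i "()"])
  have cl: "f i * A ^\<^sub>m i \<in> carrier M2" for i
    using fc[of i] Ac by (auto simp: ring_mat_simps intro!: mult_carrier_mat)
  have dg: "deg M2 f \<le> n"
    by (rule deg_aboveI) (use n f in \<open>auto simp: co ring_mat_simps\<close>)
  have z: "f i * A ^\<^sub>m i = \<zero>\<^bsub>M2\<^esub>" if "deg M2 f < i" for i
    using deg_aboveD[OF that f] Ac by (simp add: co ring_mat_simps)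
  have "mpoly_eval f A = (\<Oplus>\<^bsub>M2\<^esub>i\<in>{..deg M2 f}. f i * A ^\<^sub>m i)"
    using f by (simp add: mpoly_eval_def eval_def co pow ring_mat_simps(1))
  also have "\<dots> = (\<Oplus>\<^bsub>M2\<^esub>i\<in>{..n}. f i * A ^\<^sub>m i)"
    by (rule R.add.finprod_mono_neutral_cong_left) (use dg z cl in auto)
  finally show ?thesis .
qed

end

theory Submission
  imports Defs
begin

text \<open>
  A matrix with minimal polynomial \<open>(x - a)(x - b)\<close> is determined by its two eigenlines \<open>l \<noteq> m\<close>,
  which are arbitrary distinct points of the projective line. A polynomial \<open>f\<close> with left
  coefficients vanishes at it iff \<open>f(a)\<close> kills \<open>l\<close> and \<open>f(b)\<close> kills \<open>m\<close>. Evaluation at a scalar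
  is multiplicative, and \<open>f(a)\<close>, \<open>f(b)\<close> can be prescribed independently. Since the matrix
  ring is simple, the null ideal of a nonempty set is two-sided iff the \<open>a\<close>-eigenlines span the
  plane and so do the \<open>b\<close>-eigenlines. So the noncore sets are the nonempty sets of pairs \<open>(l, m)\<close> with
  constant first or constant second component; inclusion-exclusion counts
  \<open>2 (q + 1) (2 ^ q - 1) - (q + 1) q\<close> of them.
\<close>

section \<open>Counting sets of off-diagonal pairs with a constant component\<close>

lemma card_nonempty_subsets:
  assumes "finite A"
  shows "card (Pow A - {{}}) = 2 ^ card A - 1"
  using assms by (subst card_Diff_subset) (auto simp: card_Pow)

lemma card_aligned_subsets_offdiag:
  fixes V :: "'b set"
  assumes V: "finite V"
  defines "X \<equiv> {(l, m). l \<in> V \<and> m \<in> V \<and> l \<noteq> m}"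
  shows "int (card {T. T \<subseteq> X \<and> T \<noteq> {} \<and> ((\<exists>l. fst ` T \<subseteq> {l}) \<or> (\<exists>m. snd ` T \<subseteq> {m}))}) =
    int (card V) * (2 ^ card V - int (card V) - 1)"
proof -
  define A where "A = {T. T \<subseteq> X \<and> T \<noteq> {} \<and> (\<exists>l. fst ` T \<subseteq> {l})}"
  define B where "B = {T. T \<subseteq> X \<and> T \<noteq> {} \<and> (\<exists>m. snd ` T \<subseteq> {m})}"
  have "X \<subseteq> V \<times> V" by (auto simp: X_def)
  then have fX: "finite X" using V finite_subset by blast
  have fA: "finite A" and fB: "finite B"
    by (rule finite_subset[of _ "Pow X"]; use fX in \<open>auto simp: A_def B_def\<close>)+
  \<comment> \<open>Grouping by the constant first component; a nonempty \<open>T\<close> determines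
    \<open>l\<close>, so the union is disjoint.\<close>
  have A: "A = (\<Union>l\<in>V. Pow ({l} \<times> (V - {l})) - {{}})"
  proof (intro equalityI subsetI)
    fix T assume "T \<in> A"
    then obtain l where T: "T \<subseteq> X" "T \<noteq> {}" "fst ` T \<subseteq> {l}" unfolding A_def by blast
    have "T \<subseteq> {l} \<times> (V - {l})"
    proof
      fix p assume "p \<in> T"
      with T show "p \<in> {l} \<times> (V - {l})" by (cases p) (force simp: X_def)
    qed
    with T(2) obtain k where "(l, k) \<in> T" by blast
    with T(1) have "l \<in> V" by (auto simp: X_def)
    with \<open>T \<subseteq> {l} \<times> (V - {l})\<close> show "T \<in> (\<Union>l\<in>V. Pow ({l} \<times> (V - {l})) - {{}})"
      using T(2) by blast
  next
    fix T assume "T \<in> (\<Union>l\<in>V. Pow ({l} \<times> (V - {l})) - {{}})"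
    then obtain l where T: "l \<in> V" "T \<subseteq> {l} \<times> (V - {l})" "T \<noteq> {}" by blast
    then have "T \<subseteq> X" "fst ` T \<subseteq> {l}" by (auto simp: X_def)
    with T(3) show "T \<in> A" unfolding A_def by blast
  qed
  have "card A = (\<Sum>l\<in>V. card (Pow ({l} \<times> (V - {l})) - {{}}))"
    unfolding A using V by (intro card_UN_disjoint) auto
  also have "\<dots> = (\<Sum>l\<in>V. 2 ^ (card V - 1) - 1)"
    using V by (intro sum.cong refl, subst card_nonempty_subsets) (simp_all add: card_cartesian_product)
  finally have cA: "card A = card V * (2 ^ (card V - 1) - 1)" by simp
  \<comment> \<open>\<open>X\<close> is symmetric, so swapping coordinates exchanges the two kinds
    of sets.\<close>
  have AB: "B = (`) prod.swap ` A"
  proof (intro equalityI subsetI)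
    fix T assume "T \<in> B"
    then obtain m where m: "T \<subseteq> X" "T \<noteq> {}" "snd ` T \<subseteq> {m}"
      unfolding B_def by blast
    then have "prod.swap ` T \<subseteq> X" "fst ` prod.swap ` T \<subseteq> {m}" by (auto simp: X_def image_image)
    with m have "prod.swap ` T \<in> A" unfolding A_def by blast
    then show "T \<in> (`) prod.swap ` A"
      by (intro image_eqI[of _ _ "prod.swap ` T"]) (auto simp: image_image)
  next
    fix T assume "T \<in> (`) prod.swap ` A"
    then obtain U l where U: "T = prod.swap ` U" "U \<subseteq> X" "U \<noteq> {}" "fst ` U \<subseteq> {l}"
      unfolding A_def by blast
    then have "T \<subseteq> X" "snd ` T \<subseteq> {l}" by (auto simp: X_def image_image)
    with U show "T \<in> B" unfolding B_def by blast
  qed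
  have "inj_on ((`) prod.swap) A"
    by (rule inj_on_image) simp
  then have cB: "card B = card A"
    unfolding AB by (rule card_image)
  \<comment> \<open>With both components constant only singletons remain: the correction term of the
    inclusion-exclusion.\<close>
  have "A \<inter> B = (\<lambda>p. {p}) ` X"
  proof (intro equalityI subsetI)
    fix T assume "T \<in> A \<inter> B"
    then obtain l m where "T \<subseteq> X" "T \<noteq> {}" "fst ` T \<subseteq> {l}" "snd ` T \<subseteq> {m}"
      unfolding A_def B_def by blast
    then have "T = {(l, m)}" by fastforce
    with \<open>T \<subseteq> X\<close> show "T \<in> (\<lambda>p. {p}) ` X" by blast
  qed (auto simp: A_def B_def)
  then have cAB: "card (A \<inter> B) = card X"
    by (simp add: card_image)
  have "X = (SIGMA l:V. V - {l})" by (auto simp: X_def)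
  then have cX: "card X = card V * (card V - 1)"
    using V by simp
  have "{T. T \<subseteq> X \<and> T \<noteq> {} \<and> ((\<exists>l. fst ` T \<subseteq> {l}) \<or> (\<exists>m. snd ` T \<subseteq> {m}))} = A \<union> B"
    by (auto simp: A_def B_def)
  moreover have "int (card (A \<union> B)) = 2 * int (card A) - int (card X)"
    using card_Un_Int[OF fA fB] cB cAB by linarith
  moreover have "2 * int (card A) - int (card X) = int (card V) * (2 ^ card V - int (card V) - 1)"
  \<comment> \<open>The split removes the truncated subtractions on \<open>nat\<close>; for
    \<open>card V = 0\<close> both sides are 0.\<close>
  proof (cases "card V")
    case (Suc k)
    have "int (2 ^ k - 1) = 2 ^ k - 1" by (simp add: of_nat_diff)
    then show ?thesis
      unfolding cA cX Suc diff_Suc_1 of_nat_mult by (simp only:) (simp add: algebra_simps)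
  qed (simp add: cA cX)
  ultimately show ?thesis by simp
qed

section \<open>Polynomials over matrices as matrices of polynomials\<close>

lemma index_mult_mat_2:
  assumes "A \<in> carrier_mat 2 2" "B \<in> carrier_mat 2 2" "r < 2" "s < 2"
  shows "(A * B) $$ (r, s) = A $$ (r, 0) * B $$ (0, s) + A $$ (r, 1) * B $$ (1, s)"
  using assms by (auto simp: scalar_prod_def numeral_2_eq_2)

lemma finsum_M2_closed:
  "finite I \<Longrightarrow> (\<And>i. i \<in> I \<Longrightarrow> F i \<in> carrier_mat 2 2) \<Longrightarrow> (\<Oplus>\<^bsub>M2\<^esub>i\<in>I. F i) \<in> carrier_mat 2 2"
  using abelian_monoid.finsum_closed[OF ring.is_abelian_group[OF ring_M2, THEN abelian_group.axioms(1)]]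
  by (auto simp: ring_mat_simps Pi_def)

lemma index_finsum_M2:
  fixes F :: "'i \<Rightarrow> 'a::field mat"
  assumes "finite I" "\<And>i. i \<in> I \<Longrightarrow> F i \<in> carrier_mat 2 2" "r < 2" "s < 2"
  shows "(\<Oplus>\<^bsub>M2\<^esub>i\<in>I. F i) $$ (r, s) = (\<Sum>i\<in>I. F i $$ (r, s))"
proof -
  interpret ring "M2 :: 'a mat ring" by (rule ring_M2)
  show ?thesis using assms(1,2)
  proof (induction I rule: finite_induct)
    case empty
    then show ?case using assms(3,4) by (simp add: ring_mat_simps)
  next
    case (insert x I)
    have "(\<Oplus>\<^bsub>M2\<^esub>i\<in>insert x I. F i) = F x + (\<Oplus>\<^bsub>M2\<^esub>i\<in>I. F i)"
      using insert by (subst finsum_insert) (auto simp: ring_mat_simps)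
    then show ?case
      using insert assms(3,4) finsum_M2_closed[of I F] by auto
  qed
qed

text \<open>Passing to entries in the commutative ring \<open>'a poly\<close> makes ordinary
  polynomial evaluation available. \<open>Abs_poly\<close> is meaningful for \<open>f\<close> in
  \<open>carrier (UP M2)\<close>, whose coefficients vanish from some index on.\<close>

definition entry_poly :: "(nat \<Rightarrow> 'a::field mat) \<Rightarrow> nat \<Rightarrow> nat \<Rightarrow> 'a poly" where
  "entry_poly f r s = Abs_poly (\<lambda>k. f k $$ (r, s))"

lemma UP_M2_coeff_carrier:
  assumes "f \<in> carrier (UP M2)"
  shows "f k \<in> carrier_mat 2 2"
  using assms by (auto simp: UP_def ring_mat_simps dest: mem_upD)

lemma UP_M2_bounded:
  assumes "f \<in> carrier (UP M2)"
  obtains n where "\<And>k. n < k \<Longrightarrow> f k = 0\<^sub>m 2 2"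
proof -
  from assms obtain n where "bound (0\<^sub>m 2 2) n f"
    by (auto simp: UP_def up_def ring_mat_simps)
  with that show thesis by blast
qed

lemma coeff_entry_poly:
  assumes "f \<in> carrier (UP M2)" "r < 2" "s < 2"
  shows "coeff (entry_poly f r s) k = f k $$ (r, s)"
proof -
  obtain n where "\<And>k. n < k \<Longrightarrow> f k = 0\<^sub>m 2 2"
    using UP_M2_bounded[OF assms(1)] by blast
  then show ?thesis
    unfolding entry_poly_def using assms(2,3) by (subst coeff_Abs_poly[of n]) auto
qed

lemma entry_poly_zero:
  "r < 2 \<Longrightarrow> s < 2 \<Longrightarrow> entry_poly \<zero>\<^bsub>UP M2\<^esub> r s = 0"
  by (rule poly_eqI, subst coeff_entry_poly)
    (auto simp: UP_def ring_mat_simps intro!: mem_upI exI[of _ 0])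

lemma entry_poly_add:
  assumes "f \<in> carrier (UP M2)" "g \<in> carrier (UP M2)" "r < 2" "s < 2"
  shows "entry_poly (f \<oplus>\<^bsub>UP M2\<^esub> g) r s = entry_poly f r s + entry_poly g r s"
proof (rule poly_eqI)
  fix k
  interpret UP_ring M2 "UP M2 :: (_, nat \<Rightarrow> 'a mat) up_ring"
    by (simp add: UP_ring_def UP_def ring_M2)
  have "(f \<oplus>\<^bsub>UP M2\<^esub> g) k = f k + g k"
    using assms by (simp add: UP_def ring_mat_simps)
  then show "coeff (entry_poly (f \<oplus>\<^bsub>UP M2\<^esub> g) r s) k = coeff (entry_poly f r s + entry_poly g r s) k"
    using assms UP_M2_coeff_carrier[of f k] UP_M2_coeff_carrier[of g k]
    by (simp add: coeff_entry_poly)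
qed

text \<open>Since \<open>x\<close> commutes with the coefficients, convolution of matrix
  coefficients is the matrix product over \<open>'a poly\<close>. Hence evaluation at a scalar is
  multiplicative.\<close>

lemma entry_poly_mult:
  assumes f: "f \<in> carrier (UP M2)" and g: "g \<in> carrier (UP M2)" and "r < 2" "s < 2"
  shows "entry_poly (f \<otimes>\<^bsub>UP M2\<^esub> g) r s =
    entry_poly f r 0 * entry_poly g 0 s + entry_poly f r 1 * entry_poly g 1 s"
proof (rule poly_eqI)
  fix k
  interpret UP_ring M2 "UP M2 :: (_, nat \<Rightarrow> 'a mat) up_ring"
    by (simp add: UP_ring_def UP_def ring_M2)
  note c = UP_M2_coeff_carrier[OF f] UP_M2_coeff_carrier[OF g]
  have "(f \<otimes>\<^bsub>UP M2\<^esub> g) k = (\<Oplus>\<^bsub>M2\<^esub>i\<in>{..k}. f i * g (k - i))"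
    using f g by (simp add: UP_def ring_mat_simps(1))
  then have "coeff (entry_poly (f \<otimes>\<^bsub>UP M2\<^esub> g) r s) k = (\<Sum>i\<le>k. (f i * g (k - i)) $$ (r, s))"
    using assms by (simp add: coeff_entry_poly index_finsum_M2 mult_carrier_mat[OF c])
  also have "\<dots> = (\<Sum>i\<le>k. f i $$ (r, 0) * g (k - i) $$ (0, s) + f i $$ (r, 1) * g (k - i) $$ (1, s))"
    by (simp only: index_mult_mat_2[OF c assms(3,4)])
  also have "\<dots> = coeff (entry_poly f r 0 * entry_poly g 0 s + entry_poly f r 1 * entry_poly g 1 s) k"
    using assms by (simp add: Polynomial.coeff_mult coeff_entry_poly sum.distrib)
  finally show "coeff (entry_poly (f \<otimes>\<^bsub>UP M2\<^esub> g) r s) k = \<dots>" .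
qed

text \<open>Inverse to \<open>entry_poly\<close>; it builds witness polynomials from prescribed
  entries.\<close>

definition mpoly_of_entries :: "(nat \<Rightarrow> nat \<Rightarrow> 'a::field poly) \<Rightarrow> nat \<Rightarrow> 'a mat" where
  "mpoly_of_entries Q = (\<lambda>k. mat 2 2 (\<lambda>(r, s). coeff (Q r s) k))"

lemma mpoly_of_entries_closed: "mpoly_of_entries Q \<in> carrier (UP M2)"
proof -
  define n where "n = degree (Q 0 0) + degree (Q 0 1) + degree (Q 1 0) + degree (Q 1 1)"
  have "mpoly_of_entries Q k = 0\<^sub>m 2 2" if "n < k" for k
    using that by (auto simp: mpoly_of_entries_def n_def less_2_cases_iff coeff_eq_0 intro!: eq_matI)
  then show ?thesis
    by (auto simp: UP_def up_def ring_mat_simps bound_def mpoly_of_entries_def)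
qed

lemma entry_poly_of_entries:
  "r < 2 \<Longrightarrow> s < 2 \<Longrightarrow> entry_poly (mpoly_of_entries Q) r s = Q r s"
  by (rule poly_eqI) (simp add: coeff_entry_poly mpoly_of_entries_closed, simp add: mpoly_of_entries_def)

section \<open>Matrices with prescribed eigenlines\<close>

text \<open>
  The points of the projective line are encoded as \<open>'a option\<close>: \<open>Some t\<close> is the line through
  \<open>(t, 1)\<close> and \<open>None\<close> the line through \<open>(1, 0)\<close>.
\<close>

definition pt :: "'a::field option \<Rightarrow> nat \<Rightarrow> 'a" where
  "pt l r = (case l of None \<Rightarrow> if r = 0 then 1 else 0 | Some t \<Rightarrow> if r = 0 then t else 1)"

text \<open>A linear form, as a row vector, whose kernel is the line \<open>l\<close>.\<close>

definition ann :: "'a::field option \<Rightarrow> nat \<Rightarrow> 'a" where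
  "ann l s = (if s = 0 then pt l 1 else - pt l 0)"

text \<open>The determinant with columns \<open>pt l\<close> and \<open>pt m\<close>; swapping the
  lines changes its sign.\<close>

definition pairing :: "'a::field option \<Rightarrow> 'a option \<Rightarrow> 'a" where
  "pairing m l = ann m 0 * pt l 0 + ann m 1 * pt l 1"

lemma pairing_eq_0_iff: "pairing m l = 0 \<longleftrightarrow> l = m"
  by (auto simp: pairing_def ann_def pt_def split: option.splits)

lemma pt_nonzero: "pt l 0 \<noteq> 0 \<or> pt l 1 \<noteq> 0"
  by (auto simp: pt_def split: option.splits)

text \<open>The matrix that acts as \<open>x\<close> on the line \<open>l\<close> and as \<open>y\<close> on the line \<open>m\<close>; junk if \<open>l = m\<close>.\<close>

definition eig_mat :: "'a::field \<Rightarrow> 'a \<Rightarrow> 'a option \<Rightarrow> 'a option \<Rightarrow> 'a mat" where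
  "eig_mat x y l m =
    mat 2 2 (\<lambda>(r, s). (x * pt l r * ann m s - y * pt m r * ann l s) / pairing m l)"

lemma eig_mat_carrier: "eig_mat x y l m \<in> carrier_mat 2 2"
  by (simp add: eig_mat_def)

lemma eig_mat_index:
  "r < 2 \<Longrightarrow> s < 2 \<Longrightarrow>
    eig_mat x y l m $$ (r, s) = (x * pt l r * ann m s - y * pt m r * ann l s) / pairing m l"
  by (simp add: eig_mat_def)

text \<open>\<open>pt l r * ann m s / pairing m l\<close> is the projection onto \<open>l\<close>
  along \<open>m\<close>. As \<open>pairing l m = - pairing m l\<close>, the subtracted term yields
  the projection onto \<open>m\<close> along \<open>l\<close>. The two sum to the identity.\<close>

lemma eig_mat_one:
  assumes "l \<noteq> m"
  shows "eig_mat 1 1 l m = 1\<^sub>m 2"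
proof -
  have "pairing m l \<noteq> 0" using assms by (simp add: pairing_eq_0_iff)
  then show ?thesis
    by (intro eq_matI) (auto simp: eig_mat_def less_2_cases_iff ann_def pairing_def field_simps)
qed

text \<open>The two projections are idempotent with product zero, so the eigenvalues simply
  multiply.\<close>

lemma eig_mat_mult:
  assumes "l \<noteq> m"
  shows "eig_mat x y l m * eig_mat x' y' l m = eig_mat (x * x') (y * y') l m"
proof (rule eq_matI)
  fix r s assume "r < dim_row (eig_mat (x * x') (y * y') l m)" "s < dim_col (eig_mat (x * x') (y * y') l m)"
  then have rs: "r < 2" "s < 2" by (simp_all add: eig_mat_def)
  have d: "pairing m l \<noteq> 0" using assms by (simp add: pairing_eq_0_iff)
  have "(eig_mat x y l m * eig_mat x' y' l m) $$ (r, s) =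
      eig_mat x y l m $$ (r, 0) * eig_mat x' y' l m $$ (0, s) +
      eig_mat x y l m $$ (r, 1) * eig_mat x' y' l m $$ (1, s)"
    by (rule index_mult_mat_2[OF eig_mat_carrier eig_mat_carrier rs])
  also have "\<dots> = ((x * pt l r * ann m 0 - y * pt m r * ann l 0) * (x' * pt l 0 * ann m s - y' * pt m 0 * ann l s) +
      (x * pt l r * ann m 1 - y * pt m r * ann l 1) * (x' * pt l 1 * ann m s - y' * pt m 1 * ann l s))
      / (pairing m l * pairing m l)"
    using rs by (simp add: eig_mat_index add_divide_distrib)
  \<comment> \<open>Mixed terms apply an \<open>ann\<close> to its own point and vanish; each pure
    term yields a factor \<open>pairing m l\<close> up to sign.\<close>
  also have "\<dots> = (x * x' * pt l r * ann m s - y * y' * pt m r * ann l s) * pairing m l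
      / (pairing m l * pairing m l)"
    by (rule arg_cong[where f = "\<lambda>t. t / _"]) (simp add: pairing_def ann_def algebra_simps)
  also have "\<dots> = eig_mat (x * x') (y * y') l m $$ (r, s)"
    using rs d by (simp add: eig_mat_index)
  finally show "(eig_mat x y l m * eig_mat x' y' l m) $$ (r, s) = eig_mat (x * x') (y * y') l m $$ (r, s)" .
qed (simp_all add: eig_mat_def)

lemma eig_mat_pow: "l \<noteq> m \<Longrightarrow> eig_mat x y l m ^\<^sub>m k = eig_mat (x ^ k) (y ^ k) l m"
proof (induction k)
  case 0
  then show ?case using eig_mat_carrier[of x y l m] by (simp add: eig_mat_one)
next
  case (Suc k)
  then show ?case by (simp add: eig_mat_mult mult.commute)
qed

section \<open>Evaluation at a matrix with given eigenlines\<close>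

text \<open>
  The \<open>r\<close>-th entry of the vector \<open>f(c) v\<close>, where \<open>f\<close> is evaluated at the scalar \<open>c\<close> and \<open>v\<close>
  spans the line \<open>l\<close>.
\<close>

definition row_at :: "(nat \<Rightarrow> 'a::field mat) \<Rightarrow> 'a \<Rightarrow> 'a option \<Rightarrow> nat \<Rightarrow> 'a" where
  "row_at f c l r = poly (entry_poly f r 0) c * pt l 0 + poly (entry_poly f r 1) c * pt l 1"

lemma poly_eq_sum_bound:
  fixes p :: "'a::comm_semiring_1 poly"
  assumes "\<And>i. n < i \<Longrightarrow> coeff p i = 0"
  shows "poly p x = (\<Sum>i\<le>n. coeff p i * x ^ i)"
proof -
  have "degree p \<le> n" using assms by (intro degree_le) blast
  then show ?thesis
    unfolding poly_altdef by (intro sum.mono_neutral_left) (auto intro: coeff_eq_0 le_degree)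
qed

lemma mpoly_eval_index:
  assumes f: "f \<in> carrier (UP M2)" and A: "A \<in> carrier_mat 2 2" and n: "\<And>i. n < i \<Longrightarrow> f i = 0\<^sub>m 2 2"
    and rs: "r < 2" "s < 2"
  shows "mpoly_eval f A $$ (r, s) =
    (\<Sum>i\<le>n. f i $$ (r, 0) * (A ^\<^sub>m i) $$ (0, s) + f i $$ (r, 1) * (A ^\<^sub>m i) $$ (1, s))"
proof -
  note c = UP_M2_coeff_carrier[OF f] pow_carrier_mat[OF A]
  have "mpoly_eval f A = (\<Oplus>\<^bsub>M2\<^esub>i\<in>{..n}. f i * A ^\<^sub>m i)"
    using A by (intro mpoly_eval_eq[OF f _ n]) (simp_all add: ring_mat_simps)
  then have "mpoly_eval f A $$ (r, s) = (\<Sum>i\<le>n. (f i * A ^\<^sub>m i) $$ (r, s))"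
    using rs by (simp add: index_finsum_M2 mult_carrier_mat[OF c])
  also have "\<dots> = (\<Sum>i\<le>n. f i $$ (r, 0) * (A ^\<^sub>m i) $$ (0, s) + f i $$ (r, 1) * (A ^\<^sub>m i) $$ (1, s))"
    by (simp only: index_mult_mat_2[OF c rs])
  finally show ?thesis .
qed

lemma mpoly_eval_carrier:
  assumes f: "f \<in> carrier (UP M2)" and A: "A \<in> carrier_mat 2 2"
  shows "mpoly_eval f A \<in> carrier_mat 2 2"
proof -
  obtain n where n: "\<And>k. n < k \<Longrightarrow> f k = 0\<^sub>m 2 2"
    using UP_M2_bounded[OF f] by blast
  have "mpoly_eval f A = (\<Oplus>\<^bsub>M2\<^esub>i\<in>{..n}. f i * A ^\<^sub>m i)"
    using A by (intro mpoly_eval_eq[OF f _ n]) (simp_all add: ring_mat_simps)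
  then show ?thesis
    using mult_carrier_mat[OF UP_M2_coeff_carrier[OF f] pow_carrier_mat[OF A]]
    by (simp add: finsum_M2_closed)
qed

text \<open>Each power of the matrix is \<open>x ^ i\<close> times one fixed projection plus
  \<open>y ^ i\<close> times the other, so the coefficients of \<open>f\<close> regroup into its
  values at the scalars \<open>x\<close> and \<open>y\<close>.\<close>

lemma mpoly_eval_eig_mat_index:
  assumes f: "f \<in> carrier (UP M2)" and "l \<noteq> m" and rs: "r < 2" "s < 2"
  shows "mpoly_eval f (eig_mat x y l m) $$ (r, s) =
    (row_at f x l r * ann m s - row_at f y m r * ann l s) / pairing m l"
proof -
  obtain n where n: "\<And>k. n < k \<Longrightarrow> f k = 0\<^sub>m 2 2"
    using UP_M2_bounded[OF f] by blast
  have P: "poly (entry_poly f r t) c = (\<Sum>i\<le>n. f i $$ (r, t) * c ^ i)" if "t < 2" for t c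
    using that rs n by (subst poly_eq_sum_bound[of n]) (simp_all add: coeff_entry_poly[OF f])
  have "mpoly_eval f (eig_mat x y l m) $$ (r, s) =
    (\<Sum>i\<le>n. f i $$ (r, 0) * eig_mat (x ^ i) (y ^ i) l m $$ (0, s) +
       f i $$ (r, 1) * eig_mat (x ^ i) (y ^ i) l m $$ (1, s))"
    using mpoly_eval_index[OF f eig_mat_carrier n rs] \<open>l \<noteq> m\<close> by (simp add: eig_mat_pow)
  also have "\<dots> = (\<Sum>i\<le>n. ((f i $$ (r, 0) * x ^ i * pt l 0 + f i $$ (r, 1) * x ^ i * pt l 1) * ann m s -
      (f i $$ (r, 0) * y ^ i * pt m 0 + f i $$ (r, 1) * y ^ i * pt m 1) * ann l s) / pairing m l)"
    using rs by (intro sum.cong)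
      (simp_all add: eig_mat_index add_divide_distrib diff_divide_distrib algebra_simps)
  also have "\<dots> = (row_at f x l r * ann m s - row_at f y m r * ann l s) / pairing m l"
    by (simp add: row_at_def P sum_divide_distrib[symmetric] sum_subtractf sum.distrib
        sum_distrib_right[symmetric])
  finally show ?thesis .
qed

text \<open>The value sends \<open>pt l\<close> to \<open>f(x) (pt l)\<close> and
  \<open>pt m\<close> to \<open>f(y) (pt m)\<close>, and these points span the plane.\<close>

lemma mpoly_eval_eig_mat_eq_0_iff:
  assumes f: "f \<in> carrier (UP M2)" and "l \<noteq> m"
  shows "mpoly_eval f (eig_mat x y l m) = \<zero>\<^bsub>M2\<^esub> \<longleftrightarrow>
    (\<forall>r<2. row_at f x l r = 0 \<and> row_at f y m r = 0)"
proof
  assume z: "mpoly_eval f (eig_mat x y l m) = \<zero>\<^bsub>M2\<^esub>"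
  have d: "pairing m l \<noteq> 0" using \<open>l \<noteq> m\<close> by (simp add: pairing_eq_0_iff)
  show "\<forall>r<2. row_at f x l r = 0 \<and> row_at f y m r = 0"
  proof (intro allI impI)
    fix r :: nat assume r: "r < 2"
    have e: "row_at f x l r * ann m s = row_at f y m r * ann l s" if "s < 2" for s
      using mpoly_eval_eig_mat_index[OF f \<open>l \<noteq> m\<close> r that, of x y] z d r that
      by (simp add: ring_mat_simps)
    \<comment> \<open>Applying the row to \<open>pt l\<close> isolates the first term, since
      \<open>ann l\<close> vanishes there; applying it to \<open>pt m\<close> below isolates the
      second.\<close>
    have "row_at f x l r * pairing m l =
        row_at f x l r * ann m 0 * pt l 0 + row_at f x l r * ann m 1 * pt l 1"
      by (simp add: pairing_def algebra_simps)
    also have "\<dots> = 0" by (simp only: e) (simp add: ann_def)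
    finally have X: "row_at f x l r * pairing m l = 0" .
    have "row_at f y m r * pairing m l =
        - (row_at f y m r * ann l 0 * pt m 0 + row_at f y m r * ann l 1 * pt m 1)"
      by (simp add: pairing_def ann_def algebra_simps)
    also have "\<dots> = 0" by (simp only: e[symmetric]) (simp add: ann_def)
    finally have "row_at f y m r * pairing m l = 0" .
    with X d show "row_at f x l r = 0 \<and> row_at f y m r = 0" by simp
  qed
next
  assume "\<forall>r<2. row_at f x l r = 0 \<and> row_at f y m r = 0"
  then show "mpoly_eval f (eig_mat x y l m) = \<zero>\<^bsub>M2\<^esub>"
    using mpoly_eval_carrier[OF f eig_mat_carrier[of x y l m]]
    by (intro eq_matI) (auto simp: mpoly_eval_eig_mat_index[OF f \<open>l \<noteq> m\<close>] ring_mat_simps)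
qed

lemma row_at_of_entries:
  "r < 2 \<Longrightarrow> row_at (mpoly_of_entries Q) c l r = poly (Q r 0) c * pt l 0 + poly (Q r 1) c * pt l 1"
  by (simp add: row_at_def entry_poly_of_entries)

section \<open>The class as the set of ordered pairs of distinct lines\<close>

lemma row_at_scalar_mpoly:
  assumes "r < 2"
  shows "row_at (scalar_mpoly p) c l r = poly p c * pt l r"
proof -
  have "entry_poly (scalar_mpoly p) r s = (if r = s then p else 0)" if "s < 2" for s
    using assms that
    by (intro poly_eqI, subst coeff_entry_poly[OF scalar_mpoly_closed]) (simp_all add: scalar_mpoly_def)
  then show ?thesis using assms by (auto simp: row_at_def less_2_cases_iff)
qed

lemma scalar_mpoly_eig_mat_eq_0_iff:
  assumes "l \<noteq> m"
  shows "mpoly_eval (scalar_mpoly p) (eig_mat x y l m) = \<zero>\<^bsub>M2\<^esub> \<longleftrightarrow> poly p x = 0 \<and> poly p y = 0"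
  using pt_nonzero[of l] pt_nonzero[of m]
  by (auto simp: mpoly_eval_eig_mat_eq_0_iff[OF scalar_mpoly_closed assms] row_at_scalar_mpoly less_2_cases_iff)

text \<open>An annihilating scalar polynomial must vanish at the distinct points \<open>a\<close>
  and \<open>b\<close>, so a nonzero one has degree at least 2.\<close>

lemma eig_mat_mem_minpoly_class:
  assumes "a \<noteq> b" "l \<noteq> m"
  shows "eig_mat a b l m \<in> minpoly_class ([:- a, 1:] * [:- b, 1:])"
proof -
  have "2 \<le> degree p" if "p \<noteq> 0" "poly p a = 0" "poly p b = 0" for p
  proof -
    have "card {a, b} \<le> card {x. poly p x = 0}"
      using that by (intro card_mono poly_roots_finite) auto
    also have "\<dots> \<le> degree p" using \<open>p \<noteq> 0\<close> by (rule card_poly_roots_bound)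
    finally show ?thesis using \<open>a \<noteq> b\<close> by simp
  qed
  then have "is_minimal_poly (eig_mat a b l m) ([:- a, 1:] * [:- b, 1:])"
    unfolding is_minimal_poly_def scalar_mpoly_eig_mat_eq_0_iff[OF \<open>l \<noteq> m\<close>]
    by (auto simp: numeral_2_eq_2)
  then show ?thesis
    using eig_mat_carrier[of a b l m] by (simp add: minpoly_class_def ring_mat_simps)
qed

lemma scalar_mpoly_eval_index:
  assumes A: "A \<in> carrier_mat 2 2" and n: "degree p \<le> n" and rs: "r < 2" "s < 2"
  shows "mpoly_eval (scalar_mpoly p) A $$ (r, s) = (\<Sum>i\<le>n. coeff p i * (A ^\<^sub>m i) $$ (r, s))"
proof -
  have "scalar_mpoly p i = 0\<^sub>m 2 2" if "n < i" for i
    using that n by (auto simp: scalar_mpoly_def coeff_eq_0 intro!: eq_matI)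
  then have "mpoly_eval (scalar_mpoly p) A $$ (r, s) =
    (\<Sum>i\<le>n. scalar_mpoly p i $$ (r, 0) * (A ^\<^sub>m i) $$ (0, s) + scalar_mpoly p i $$ (r, 1) * (A ^\<^sub>m i) $$ (1, s))"
    by (rule mpoly_eval_index[OF scalar_mpoly_closed A _ rs])
  also have "\<dots> = (\<Sum>i\<le>n. coeff p i * (A ^\<^sub>m i) $$ (r, s))"
    using rs by (intro sum.cong) (auto simp: scalar_mpoly_def less_2_cases_iff)
  finally show ?thesis .
qed

lemma minpoly_class_quadratic_entries:
  assumes "A \<in> minpoly_class ([:- a, 1:] * [:- b, 1:])" and rs: "r < 2" "s < 2"
  shows "A $$ (r, 0) * A $$ (0, s) + A $$ (r, 1) * A $$ (1, s) - (a + b) * A $$ (r, s)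
    + (if r = s then a * b else 0) = 0"
proof -
  let ?m = "[:- a, 1:] * [:- b, 1:]"
  from assms have A: "A \<in> carrier_mat 2 2" and "mpoly_eval (scalar_mpoly ?m) A = 0\<^sub>m 2 2"
    by (simp_all add: minpoly_class_def is_minimal_poly_def ring_mat_simps)
  then have "(\<Sum>i\<le>2. coeff ?m i * (A ^\<^sub>m i) $$ (r, s)) = 0"
    using scalar_mpoly_eval_index[OF A _ rs, of ?m 2] rs by simp
  moreover have "A ^\<^sub>m 2 = A * A" using A by (simp add: numeral_2_eq_2)
  ultimately show ?thesis
    using A rs index_mult_mat_2[OF A A rs]
    by (simp add: numeral_2_eq_2 algebra_simps split: if_splits)
qed

text \<open>Otherwise \<open>x - c\<close> would annihilate \<open>A\<close>, against the minimality
  of degree 2.\<close>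

lemma minpoly_class_nonscalar:
  assumes "A \<in> minpoly_class ([:- a, 1:] * [:- b, 1:])"
  shows "A \<noteq> c \<cdot>\<^sub>m 1\<^sub>m 2"
proof
  assume Ac: "A = c \<cdot>\<^sub>m 1\<^sub>m 2"
  then have A: "A \<in> carrier_mat 2 2" by simp
  have "mpoly_eval (scalar_mpoly [:- c, 1:]) A = \<zero>\<^bsub>M2\<^esub>"
  proof (rule eq_matI)
    fix r s assume "r < dim_row (\<zero>\<^bsub>M2\<^esub> :: 'a mat)" "s < dim_col (\<zero>\<^bsub>M2\<^esub> :: 'a mat)"
    then have rs: "r < 2" "s < 2" by (simp_all add: ring_mat_simps)
    show "mpoly_eval (scalar_mpoly [:- c, 1:]) A $$ (r, s) = \<zero>\<^bsub>M2\<^esub> $$ (r, s)"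
      using rs A by (subst scalar_mpoly_eval_index[OF A, of _ 1])
        (simp_all add: ring_mat_simps, simp add: Ac)
  qed (use mpoly_eval_carrier[OF scalar_mpoly_closed A, of "[:- c, 1:]"] in \<open>auto simp: ring_mat_simps\<close>)
  moreover have "[:- c, 1:] \<noteq> 0" by simp
  ultimately have "degree ([:- a, 1:] * [:- b, 1:]) \<le> degree [:- c, 1:]"
    using assms unfolding minpoly_class_def is_minimal_poly_def by blast
  then show False by simp
qed

text \<open>The eigenlines are solved for explicitly from the entries, according to whether
  \<open>A\<close> is upper triangular.\<close>

lemma minpoly_class_eq_eig_mat:
  fixes a b :: "'a::field"
  assumes "a \<noteq> b" and mem: "A \<in> minpoly_class ([:- a, 1:] * [:- b, 1:])"
  shows "\<exists>l m. l \<noteq> m \<and> A = eig_mat a b l m"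
proof -
  from mem have A: "A \<in> carrier_mat 2 2" by (simp add: minpoly_class_def ring_mat_simps)
  define p q u v where "p = A $$ (0, 0)" and "q = A $$ (0, 1)" and "u = A $$ (1, 0)" and "v = A $$ (1, 1)"
  note defs = p_def q_def u_def v_def
  have e: "p * p + q * u - (a + b) * p + a * b = 0" "p * q + q * v - (a + b) * q = 0"
    "u * p + v * u - (a + b) * u = 0" "u * q + v * v - (a + b) * v + a * b = 0"
    using minpoly_class_quadratic_entries[OF mem, of 0 0] minpoly_class_quadratic_entries[OF mem, of 0 1]
      minpoly_class_quadratic_entries[OF mem, of 1 0] minpoly_class_quadratic_entries[OF mem, of 1 1]
    by (simp_all add: defs)
  have ns: "\<not> (q = 0 \<and> u = 0 \<and> p = v)"
  proof
    assume "q = 0 \<and> u = 0 \<and> p = v"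
    then have "A = p \<cdot>\<^sub>m 1\<^sub>m 2"
      using A by (intro eq_matI) (auto simp: less_2_cases_iff defs)
    with minpoly_class_nonscalar[OF mem] show False by blast
  qed
  \<comment> \<open>Equality of entries with the denominator \<open>pairing m l\<close>
    cleared.\<close>
  have eqI: "A = eig_mat a b l m" if
    "p * pairing m l = a * pt l 0 * pt m 1 - b * pt m 0 * pt l 1"
    "q * pairing m l = (b - a) * pt l 0 * pt m 0"
    "u * pairing m l = (a - b) * pt l 1 * pt m 1"
    "v * pairing m l = b * pt m 1 * pt l 0 - a * pt l 1 * pt m 0" "l \<noteq> m" for l m
  proof (rule eq_matI)
    fix r s assume "r < dim_row (eig_mat a b l m)" "s < dim_col (eig_mat a b l m)"
    moreover have "pairing m l \<noteq> 0" using \<open>l \<noteq> m\<close> by (simp add: pairing_eq_0_iff)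
    ultimately show "A $$ (r, s) = eig_mat a b l m $$ (r, s)"
      using that(1-4) by (auto simp: eig_mat_def less_2_cases_iff defs ann_def field_simps)
  qed (use A in \<open>auto simp: eig_mat_def\<close>)
  show ?thesis
  proof (cases "u = 0")
    case False
    \<comment> \<open>For \<open>u\<close> nonzero the lower left equation forces trace
      \<open>a + b\<close>; the upper left one then determines \<open>q\<close>.\<close>
    have "u * (p + v - (a + b)) = u * p + v * u - (a + b) * u" by (simp add: algebra_simps)
    then have "u * (p + v - (a + b)) = 0" using e(3) by simp
    then have tr: "v = a + b - p" using False by (simp add: eq_diff_eq add.commute)
    have "q * u + (a - v) * (b - v) = p * p + q * u - (a + b) * p + a * b"
      unfolding tr by (simp add: algebra_simps)
    then have "q * u = - ((a - v) * (b - v))" using e(1) by (simp add: eq_neg_iff_add_eq_0)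
    then have q: "q = - ((a - v) * (b - v)) / u" using False by (simp add: field_simps)
    \<comment> \<open>The second row of \<open>A w = c w\<close> is solved by
      \<open>w = (c - v, u)\<close>, for \<open>c = a\<close> and \<open>c = b\<close>.\<close>
    define l where "l = Some ((a - v) / u)"
    define m where "m = Some ((b - v) / u)"
    have "l \<noteq> m" using \<open>a \<noteq> b\<close> False by (simp add: l_def m_def)
    moreover have "A = eig_mat a b l m"
    proof (rule eqI)
      have P: "pairing m l = (a - b) / u"
        using False by (simp add: pairing_def ann_def pt_def l_def m_def field_simps)
      show "p * pairing m l = a * pt l 0 * pt m 1 - b * pt m 0 * pt l 1"
        using False unfolding P by (simp add: pt_def l_def m_def tr field_simps)
      show "u * pairing m l = (a - b) * pt l 1 * pt m 1"
        using False unfolding P by (simp add: pt_def l_def m_def)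
      show "v * pairing m l = b * pt m 1 * pt l 0 - a * pt l 1 * pt m 0"
        using False unfolding P by (simp add: pt_def l_def m_def field_simps)
      have "q * pairing m l = (- ((a - v) * (b - v)) * (a - b)) / (u * u)"
        unfolding P by (subst q) simp
      also have "- ((a - v) * (b - v)) * (a - b) = (b - a) * (a - v) * (b - v)"
        by (simp add: algebra_simps)
      finally show "q * pairing m l = (b - a) * pt l 0 * pt m 0"
        by (simp add: pt_def l_def m_def)
    qed fact
    ultimately show ?thesis by blast
  next
    case u: True
    have p: "(p - a) * (p - b) = 0" and v: "(v - a) * (v - b) = 0"
      using e(1,4) u by (simp_all add: algebra_simps)
    \<comment> \<open>Equal diagonal entries would give \<open>q\<close> times \<open>a - b\<close>,
      up to sign, equal to 0, so \<open>A\<close> would be scalar.\<close>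
    have pv: "p \<noteq> v"
    proof
      assume "p = v"
      then have "q * (p + p - (a + b)) = 0" using e(2) by (simp add: algebra_simps)
      moreover have "p + p - (a + b) \<noteq> 0"
      proof -
        have "p = a \<or> p = b" using p by auto
        with \<open>a \<noteq> b\<close> show ?thesis by auto
      qed
      ultimately show False using ns u \<open>p = v\<close> by simp
    qed
    then consider "p = a" "v = b" | "p = b" "v = a" using p v by auto
    then show ?thesis
    proof cases
      case 1
      \<comment> \<open>In both cases \<open>(1, 0)\<close> is an eigenvector for \<open>p\<close>,
        and the first row of \<open>A w = v w\<close> gives the other line.\<close>
      have "A = eig_mat a b None (Some (q / (b - a)))"
        using \<open>a \<noteq> b\<close> u 1 by (intro eqI) (simp_all add: pairing_def ann_def pt_def)
      then show ?thesis by blast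
    next
      case 2
      have "A = eig_mat a b (Some (q / (a - b))) None"
        using \<open>a \<noteq> b\<close> u 2 by (intro eqI) (simp_all add: pairing_def ann_def pt_def field_simps)
      then show ?thesis by blast
    qed
  qed
qed

lemma eig_mat_inj:
  fixes a b :: "'a::field"
  assumes "a \<noteq> b" "l \<noteq> m" "l' \<noteq> m'" and eq: "eig_mat a b l m = eig_mat a b l' m'"
  shows "l = l' \<and> m = m'"
proof -
  \<comment> \<open>\<open>F l b\<close> annihilates the matrix with eigenlines \<open>l\<close>, \<open>m\<close>, hence also the one with \<open>l'\<close>, \<open>m'\<close>.\<close>
  define F where "F k d = mpoly_of_entries (\<lambda>r s. smult (ann k s) [:- d, 1:])" for k and d :: 'a
  have F: "F k d \<in> carrier (UP M2)" for k d by (simp add: F_def mpoly_of_entries_closed)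
  have row: "row_at (F k d) c h r = (c - d) * pairing k h" if "r < 2" for k h c d r
    using that by (simp add: F_def row_at_of_entries pairing_def algebra_simps)
  \<comment> \<open>\<open>F l b\<close> kills \<open>pt l\<close> through \<open>ann l\<close> and
    \<open>pt m\<close> through the factor \<open>x - b\<close>. At \<open>a\<close> on
    \<open>l'\<close> its value is \<open>(a - b) * pairing l l'\<close>. \<open>F m a\<close>
    exchanges the roles.\<close>
  have "mpoly_eval (F l b) (eig_mat a b l m) = \<zero>\<^bsub>M2\<^esub>" "mpoly_eval (F m a) (eig_mat a b l m) = \<zero>\<^bsub>M2\<^esub>"
    by (simp_all add: mpoly_eval_eig_mat_eq_0_iff[OF F \<open>l \<noteq> m\<close>] row pairing_eq_0_iff)
  then have "pairing l l' = 0" "pairing m m' = 0"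
    unfolding eq mpoly_eval_eig_mat_eq_0_iff[OF F \<open>l' \<noteq> m'\<close>]
    using \<open>a \<noteq> b\<close> row[of 0] by (metis mult_eq_0_iff pos2 right_minus_eq)+
  then show ?thesis by (simp add: pairing_eq_0_iff)
qed

section \<open>Two-sidedness of null ideals\<close>

definition vanishing :: "'a::field \<Rightarrow> 'a option set \<Rightarrow> 'a \<Rightarrow> 'a option set \<Rightarrow> (nat \<Rightarrow> 'a mat) set" where
  "vanishing a L b M = {f \<in> carrier (UP M2).
    (\<forall>l\<in>L. \<forall>r<2. row_at f a l r = 0) \<and> (\<forall>m\<in>M. \<forall>r<2. row_at f b m r = 0)}"

text \<open>Reduces a constant second component to a constant first one.\<close>

lemma vanishing_commute: "vanishing a L b M = vanishing b M a L"
  by (auto simp: vanishing_def)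

text \<open>The conditions at \<open>a\<close> and \<open>b\<close> decouple: how the eigenlines are
  paired does not affect the null ideal.\<close>

lemma null_ideal_eig_mat:
  assumes "T \<subseteq> {(l, m). l \<noteq> m}"
  shows "null_ideal ((\<lambda>(l, m). eig_mat a b l m) ` T) = vanishing a (fst ` T) b (snd ` T)"
proof -
  have H: "(\<forall>A\<in>(\<lambda>(l, m). eig_mat a b l m) ` T. mpoly_eval f A = \<zero>\<^bsub>M2\<^esub>) \<longleftrightarrow>
      (\<forall>p\<in>T. \<forall>r<2. row_at f a (fst p) r = 0 \<and> row_at f b (snd p) r = 0)"
    if f: "f \<in> carrier (UP M2)" for f
    unfolding ball_simps
  proof (rule ball_cong[OF refl])
    fix p assume "p \<in> T"
    then show "mpoly_eval f (case p of (l, m) \<Rightarrow> eig_mat a b l m) = \<zero>\<^bsub>M2\<^esub> \<longleftrightarrow>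
      (\<forall>r<2. row_at f a (fst p) r = 0 \<and> row_at f b (snd p) r = 0)"
      using mpoly_eval_eig_mat_eq_0_iff[OF f, of "fst p" "snd p" a b] assms
      by (cases p) auto
  qed
  have "null_ideal ((\<lambda>(l, m). eig_mat a b l m) ` T) =
      {f \<in> carrier (UP M2). \<forall>p\<in>T. \<forall>r<2. row_at f a (fst p) r = 0 \<and> row_at f b (snd p) r = 0}"
    unfolding null_ideal_def by (intro Collect_cong conj_cong refl H)
  also have "\<dots> = vanishing a (fst ` T) b (snd ` T)"
    unfolding vanishing_def by fastforce
  finally show ?thesis .
qed

lemma row_at_eq_0_two_points:
  assumes "row_at f c l r = 0" "row_at f c l' r = 0" "l \<noteq> l'" "s < 2"
  shows "poly (entry_poly f r s) c = 0"
proof -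
  define X Y where "X = poly (entry_poly f r 0) c" and "Y = poly (entry_poly f r 1) c"
  have e: "X * pt l 0 + Y * pt l 1 = 0" "X * pt l' 0 + Y * pt l' 1 = 0"
    using assms(1,2) by (simp_all add: row_at_def X_def Y_def)
  \<comment> \<open>Cramer's rule for the system \<open>e\<close>, with determinant
    \<open>pairing l' l\<close>.\<close>
  have "X * pairing l' l = (X * pt l 0 + Y * pt l 1) * pt l' 1 - (X * pt l' 0 + Y * pt l' 1) * pt l 1"
    "Y * pairing l' l = (X * pt l' 0 + Y * pt l' 1) * pt l 0 - (X * pt l 0 + Y * pt l 1) * pt l' 0"
    by (simp_all add: pairing_def ann_def algebra_simps)
  then have "X = 0" "Y = 0" unfolding e using \<open>l \<noteq> l'\<close> by (simp_all add: pairing_eq_0_iff)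
  with \<open>s < 2\<close> show ?thesis by (auto simp: less_2_cases_iff X_def Y_def)
qed

lemma UP_ring_M2: "UP_ring (M2 :: 'a::field mat ring)"
  by (simp add: UP_ring_def ring_M2)

lemma ring_UP_M2: "ring (UP (M2 :: 'a::field mat ring))"
  by (rule UP_ring.UP_ring[OF UP_ring_M2])

text \<open>Two distinct lines at each scalar force \<open>f(a) = 0\<close> and
  \<open>f(b) = 0\<close>. Evaluation at a scalar is a ring homomorphism, so this is an intersection
  of two kernels.\<close>

lemma ideal_vanishing:
  fixes a b :: "'a::field"
  assumes "l \<in> L" "l' \<in> L" "l \<noteq> l'" "m \<in> M" "m' \<in> M" "m \<noteq> m'"
  shows "ideal (vanishing a L b M) (UP M2)"
proof -
  interpret ring "UP (M2 :: 'a mat ring)" by (rule ring_UP_M2)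
  have eq: "vanishing a L b M = {f \<in> carrier (UP M2).
      \<forall>r<2. \<forall>s<2. poly (entry_poly f r s) a = 0 \<and> poly (entry_poly f r s) b = 0}" (is "_ = ?I")
  proof (intro equalityI subsetI)
    fix f assume "f \<in> vanishing a L b M"
    with assms show "f \<in> ?I"
      unfolding vanishing_def using row_at_eq_0_two_points[of f _ l _ l'] row_at_eq_0_two_points[of f _ m _ m']
      by blast
  qed (auto simp: vanishing_def row_at_def)
  have uminus: "entry_poly (\<ominus>\<^bsub>UP M2\<^esub> f) r s = - entry_poly f r s"
    if "f \<in> carrier (UP M2)" "r < 2" "s < 2" for f :: "nat \<Rightarrow> 'a mat" and r s
  proof -
    have "f \<oplus>\<^bsub>UP M2\<^esub> (\<ominus>\<^bsub>UP M2\<^esub> f) = \<zero>\<^bsub>UP M2\<^esub>" using that(1) by (rule r_neg)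
    then have "entry_poly f r s + entry_poly (\<ominus>\<^bsub>UP M2\<^esub> f) r s = 0"
      using that by (simp add: entry_poly_add[symmetric] entry_poly_zero)
    then show ?thesis by (simp add: eq_neg_iff_add_eq_0 add.commute)
  qed
  show ?thesis unfolding eq
  proof (rule idealI)
    show "ring (UP (M2 :: 'a mat ring))" by (rule ring_UP_M2)
    show "subgroup ?I (add_monoid (UP M2))"
    proof (rule add.subgroupI)
      have "\<zero>\<^bsub>UP M2\<^esub> \<in> ?I" by (simp add: entry_poly_zero)
      then show "?I \<noteq> {}" by blast
    qed (auto simp: uminus a_inv_def[symmetric] entry_poly_add)
  qed (auto simp: entry_poly_mult)
qed

lemma not_ideal_vanishing:
  fixes a b :: "'a::field"
  assumes "a \<noteq> b"
  shows "\<not> ideal (vanishing a {l} b M) (UP M2)"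
proof
  assume I: "ideal (vanishing a {l} b M) (UP M2)"
  \<comment> \<open>\<open>f(b) = 0\<close> and \<open>f(a)\<close> kills exactly the line \<open>l\<close>; the constant \<open>h\<close> moves \<open>l\<close> off itself.\<close>
  define f where "f = mpoly_of_entries (\<lambda>r s. smult (ann l s) [:- b, 1:])"
  define g :: "nat \<Rightarrow> nat \<Rightarrow> 'a" where
    "g = (\<lambda>r s. if r \<noteq> s \<and> (r = 0 \<longleftrightarrow> pt l 1 \<noteq> 0) then 1 else 0)"
  define h where "h = mpoly_of_entries (\<lambda>r s. [:g r s:])"
  have c: "f \<in> carrier (UP M2)" "h \<in> carrier (UP M2)"
    by (simp_all add: f_def h_def mpoly_of_entries_closed)
  have "f \<in> vanishing a {l} b M"
    using c(1) by (simp add: vanishing_def f_def row_at_of_entries ann_def algebra_simps)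
  then have "f \<otimes>\<^bsub>UP M2\<^esub> h \<in> vanishing a {l} b M"
    using c(2) by (rule ideal.I_r_closed[OF I])
  then have "row_at (f \<otimes>\<^bsub>UP M2\<^esub> h) a l 0 = 0" by (simp add: vanishing_def)
  \<comment> \<open>Right multiplication lets \<open>h\<close> act on \<open>pt l\<close> before
    \<open>ann l\<close> is applied. \<open>h\<close> is the matrix unit taking \<open>pt l\<close>
    to a multiple of \<open>(1, 0)\<close> if \<open>pt l 1\<close> is nonzero, and
    \<open>(1, 0)\<close> to \<open>(0, 1)\<close> otherwise, so the right side is nonzero.\<close>
  moreover have "row_at (f \<otimes>\<^bsub>UP M2\<^esub> h) a l 0 =
    (a - b) * (pt l 1 * (g 0 0 * pt l 0 + g 0 1 * pt l 1) - pt l 0 * (g 1 0 * pt l 0 + g 1 1 * pt l 1))"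
    using c by (simp add: row_at_def entry_poly_mult)
      (simp add: f_def h_def entry_poly_of_entries ann_def algebra_simps)
  ultimately show False
    using \<open>a \<noteq> b\<close> pt_nonzero[of l] by (auto simp: g_def split: if_splits)
qed

lemma noncore_eig_mat_image_iff:
  fixes a b :: "'a::field"
  assumes "a \<noteq> b" and T: "T \<subseteq> {(l, m). l \<noteq> m}"
  shows "noncore ((\<lambda>(l, m). eig_mat a b l m) ` T) \<longleftrightarrow>
    T \<noteq> {} \<and> ((\<exists>l. fst ` T \<subseteq> {l}) \<or> (\<exists>m. snd ` T \<subseteq> {m}))"
proof (cases "T = {}")
  case True
  interpret ring "UP (M2 :: 'a mat ring)" by (rule ring_UP_M2)
  \<comment> \<open>The null ideal of the empty set is the whole ring, hence two-sided.\<close>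
  show ?thesis using True oneideal by (simp add: core_def null_ideal_def)
next
  case False
  have noncore: "noncore ((\<lambda>(l, m). eig_mat a b l m) ` T) \<longleftrightarrow> \<not> ideal (vanishing a (fst ` T) b (snd ` T)) (UP M2)"
    by (simp add: core_def null_ideal_eig_mat[OF T])
  consider l where "fst ` T = {l}" | m where "snd ` T = {m}"
    | "\<nexists>l. fst ` T \<subseteq> {l}" "\<nexists>m. snd ` T \<subseteq> {m}"
    using False by (meson image_is_empty subset_singletonD)
  then show ?thesis
  proof cases
    case (1 l)
    then show ?thesis using False not_ideal_vanishing[OF \<open>a \<noteq> b\<close>] noncore by auto
  next
    case (2 m)
    then show ?thesis
      using False not_ideal_vanishing[of b a m] \<open>a \<noteq> b\<close> noncore by (auto simp: vanishing_commute[of a])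
  next
    case 3
    from False obtain l m where "l \<in> fst ` T" "m \<in> snd ` T" by auto
    moreover have "\<not> fst ` T \<subseteq> {l}" using 3(1) by blast
    then obtain l' where "l' \<in> fst ` T" "l \<noteq> l'" by blast
    moreover have "\<not> snd ` T \<subseteq> {m}" using 3(2) by blast
    then obtain m' where "m' \<in> snd ` T" "m \<noteq> m'" by blast
    ultimately have "ideal (vanishing a (fst ` T) b (snd ` T)) (UP M2)"
      by (intro ideal_vanishing)
    with 3 noncore show ?thesis by blast
  qed
qed

section \<open>Counting the noncore subsets of a class\<close>

theorem theorem3:
  fixes C :: "'a::{field,finite} mat set"
  assumes "SQD_class C"
  shows "int (card {S. S \<subseteq> C \<and> noncore S}) =
    (int CARD('a) + 1) * (2 ^ (CARD('a) + 1) - int CARD('a) - 2)"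
proof -
  from assms obtain a b where "a \<noteq> b" and C: "C = minpoly_class ([:- a, 1:] * [:- b, 1:])"
    unfolding SQD_class_def by blast
  define X :: "('a option \<times> 'a option) set" where "X = {(l, m). l \<noteq> m}"
  define E where "E = (\<lambda>(l, m). eig_mat a b l m)"
  have CX: "C = E ` X"
  proof (intro equalityI subsetI)
    fix A assume "A \<in> C"
    then obtain l m where "l \<noteq> m" "A = eig_mat a b l m"
      using minpoly_class_eq_eig_mat[OF \<open>a \<noteq> b\<close>] unfolding C by blast
    then show "A \<in> E ` X" by (intro image_eqI[of _ _ "(l, m)"]) (simp_all add: E_def X_def)
  next
    fix A assume "A \<in> E ` X"
    then obtain l m where "l \<noteq> m" "A = eig_mat a b l m" by (auto simp: E_def X_def)
    then show "A \<in> C" 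
      unfolding C by (metis eig_mat_mem_minpoly_class \<open>a \<noteq> b\<close>)
  qed
  have inj: "inj_on E X"
  proof (rule inj_onI)
    fix x y assume "x \<in> X" "y \<in> X" "E x = E y"
    then show "x = y"
      using eig_mat_inj[OF \<open>a \<noteq> b\<close>, of "fst x" "snd x" "fst y" "snd y"]
      by (simp add: X_def E_def case_prod_beta prod_eq_iff)
  qed
  define N where "N = {T. T \<subseteq> X \<and> T \<noteq> {} \<and> ((\<exists>l. fst ` T \<subseteq> {l}) \<or> (\<exists>m. snd ` T \<subseteq> {m}))}"
  have N: "noncore (E ` T) \<longleftrightarrow> T \<in> N" if "T \<subseteq> X" for T
    using noncore_eig_mat_image_iff[OF \<open>a \<noteq> b\<close>, of T] that by (simp add: E_def N_def X_def)
  have "{S. S \<subseteq> C \<and> noncore S} = (`) E ` N"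
  proof (intro equalityI subsetI)
    fix S assume "S \<in> {S. S \<subseteq> C \<and> noncore S}"
    then obtain T where "T \<subseteq> X" "S = E ` T" "noncore S" unfolding CX by (auto elim: subset_imageE)
    with N show "S \<in> (`) E ` N" by blast
  next
    fix S assume "S \<in> (`) E ` N"
    then obtain T where T: "T \<in> N" "S = E ` T" by blast
    then have "T \<subseteq> X" by (simp add: N_def)
    with N T show "S \<in> {S. S \<subseteq> C \<and> noncore S}" unfolding CX by blast
  qed
  moreover have "inj_on ((`) E) N"
    by (rule inj_on_subset[OF inj_on_image_Pow[OF inj]]) (auto simp: N_def)
  ultimately have "card {S. S \<subseteq> C \<and> noncore S} = card N"
    by (simp add: card_image)
  \<comment> \<open>The projective line, encoded by \<open>'a option\<close>, has
    \<open>CARD('a) + 1\<close> points.\<close>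
  moreover have "int (card N) =
    int CARD('a option) * (2 ^ CARD('a option) - int CARD('a option) - 1)"
    unfolding N_def X_def using card_aligned_subsets_offdiag[of "UNIV :: 'a option set"] by simp
  ultimately show ?thesis by (simp add: algebra_simps)
qed

end
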